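(* For $\nu=(\nu_1,\ldots,\nu_5)\in\mathbb{R}^5$ let $L_r(\nu)=L+\nu_1M_1+\nu_2M_4+\nu_3M_6+\nu_4M_8+\nu_5M_5$ be the reduced centralizer unfolding of $L$. The boundary of the stability domain of $L_r$ is contained in the critical set $C=\{\nu\in\mathbb{R}^5 : F(\nu)=0\}$, where $$F(\nu)=(\nu_1^2-\nu_2^2)(\nu_1^2+\nu_4^2)+\nu_1^2\nu_3^2.$$
   Context: Let $I=\begin{pmatrix}1&0\\0&1\end{pmatrix}$, $R=\begin{pmatrix}1&0\\0&-1\end{pmatrix}$, $J=\begin{pmatrix}0&1\\-1&0\end{pmatrix}$, and (in $2\times2$ blocks) $M_1=\begin{pmatrix}I&0\\0&I\end{pmatrix}$, $M_4=\begin{pmatrix}0&J\\-J&0\end{pmatrix}$, $M_5=L=\begin{pmatrix}0&I\\-I&0\end{pmatrix}$, $M_6=\begin{pmatrix}0&R\\-R&0\end{pmatrix}$, $M_8=\begin{pmatrix}J&0\\0&J\end{pmatrix}$. The stability domain of $L_r$ is the set of $\nu\in\mathbb{R}^5$ such that every eigenvalue $\lambda$ of $L_r(\nu)$ satisfies $\mathrm{Re}(\lambda)<0$; its boundary is the topological boundary in $\mathbb{R}^5$. *)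

theory Defs
  imports "HOL-Analysis.Analysis" "Jordan_Normal_Form.Char_Poly"
begin

text \<open>
  Square matrices and their eigenvalues are those of \<open>Jordan_Normal_Form\<close>; parameter space is
  the Euclidean space \<open>real ^ 5\<close> of \<open>HOL-Analysis\<close>. Both libraries use \<open>$\<close> for components;
  it is kept for \<open>real ^ 5\<close> only. In the numeral type \<open>5\<close> indices are taken modulo 5, so
  \<open>\<nu> $ 1, \<dots>, \<nu> $ 5\<close> are the five components.
\<close>

no_notation vec_index (infixl "$" 100)

definition matR :: "real mat" where
  "matR = mat_of_rows_list 2 [[1, 0], [0, -1]]"

definition matJ :: "real mat" where
  "matJ = mat_of_rows_list 2 [[0, 1], [-1, 0]]"

definition M1 :: "real mat" where
  "M1 = four_block_mat (1\<^sub>m 2) (0\<^sub>m 2 2) (0\<^sub>m 2 2) (1\<^sub>m 2)"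

definition M4 :: "real mat" where
  "M4 = four_block_mat (0\<^sub>m 2 2) matJ (- matJ) (0\<^sub>m 2 2)"

definition M5 :: "real mat" where
  "M5 = four_block_mat (0\<^sub>m 2 2) (1\<^sub>m 2) (- (1\<^sub>m 2)) (0\<^sub>m 2 2)"

definition M6 :: "real mat" where
  "M6 = four_block_mat (0\<^sub>m 2 2) matR (- matR) (0\<^sub>m 2 2)"

definition M8 :: "real mat" where
  "M8 = four_block_mat matJ (0\<^sub>m 2 2) (0\<^sub>m 2 2) matJ"

definition matL :: "real mat" where
  "matL = M5"

definition L_r :: "real ^ 5 \<Rightarrow> real mat" where
  "L_r \<nu> = matL + \<nu> $ 1 \<cdot>\<^sub>m M1 + \<nu> $ 2 \<cdot>\<^sub>m M4 + \<nu> $ 3 \<cdot>\<^sub>m M6 + \<nu> $ 4 \<cdot>\<^sub>m M8 + \<nu> $ 5 \<cdot>\<^sub>m M5"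

text \<open>Eigenvalues of a real matrix are its complex ones, hence the coercion of the entries.\<close>

definition stability_domain :: "(real ^ 5 \<Rightarrow> real mat) \<Rightarrow> (real ^ 5) set" where
  "stability_domain A =
     {\<nu>. \<forall>z. eigenvalue (map_mat complex_of_real (A \<nu>)) z \<longrightarrow> Re z < 0}"

definition F :: "real ^ 5 \<Rightarrow> real" where
  "F \<nu> = ((\<nu> $ 1)\<^sup>2 - (\<nu> $ 2)\<^sup>2) * ((\<nu> $ 1)\<^sup>2 + (\<nu> $ 4)\<^sup>2) + (\<nu> $ 1)\<^sup>2 * (\<nu> $ 3)\<^sup>2"

definition critical_set :: "(real ^ 5) set" where
  "critical_set = {\<nu>. F \<nu> = 0}"

end

theory Submission
  imports Defs
begin

text \<open>
  Write \<open>a, b, c, d, e\<close> for \<open>\<nu>\<^sub>1, \<dots>, \<nu>\<^sub>5\<close>. The matrix \<open>L_r \<nu>\<close> consists of the four blocks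
  \<open>X, B, - B, X\<close> with \<open>X = a I + d J\<close> and \<open>B = (1 + e) I + b J + c R\<close>. Over the complex numbers
  such a matrix splits into \<open>X + \<i> B\<close> and \<open>X - \<i> B\<close> (\<open>det_four_block_mat_skew\<close>). As \<open>J\<close> and \<open>R\<close>
  anticommute, with \<open>J\<^sup>2 = - I\<close> and \<open>R\<^sup>2 = I\<close>, the first summand has the eigenvalues
  \<open>a + \<i> (1 + e) \<plusminus> s\<close> with
    \<open>s\<^sup>2 = - (d + \<i> b)\<^sup>2 - c\<^sup>2 = b\<^sup>2 - c\<^sup>2 - d\<^sup>2 - 2 \<i> b d\<close>,
  and the second one has their conjugates (\<open>eigenvalue_L_r_iff\<close>).

  Choose the square root \<open>s = p + \<i> q\<close> with \<open>p \<ge> 0\<close>. The largest real part of an eigenvalue is then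
  \<open>a + p\<close>, so stability means \<open>a < 0\<close> and \<open>p\<^sup>2 < a\<^sup>2\<close>. The function \<open>F\<close> detects this, because it
  factors as \<open>F \<nu> = (a\<^sup>2 - p\<^sup>2) (a\<^sup>2 + q\<^sup>2)\<close> (\<open>F_eq_csqrt_discr\<close>). Hence the stability domain is the
  open set where \<open>a < 0 < F \<nu>\<close> (\<open>stability_domain_L_r\<close>).

  At a boundary point \<open>a \<le> 0 \<le> F \<nu>\<close> by continuity, and one of the two inequalities is an
  equality. If it is the first one, then \<open>F \<nu> = - (b d)\<^sup>2 \<le> 0\<close>, so that \<open>F \<nu> = 0\<close> in this case too.
\<close>

lemma det_two_dim:
  assumes "A \<in> carrier_mat 2 2"
  shows "det A = A $$ (0, 0) * A $$ (1, 1) - A $$ (0, 1) * A $$ (1, 0)"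
proof -
  have "det (mat_delete A i 0) = mat_delete A i 0 $$ (0, 0)" for i
    using assms by (intro det_single) (auto simp: mat_delete_def)
  then show ?thesis
    using assms
    by (subst laplace_expansion_column[of A 2 0])
       (auto simp: numeral_2_eq_2 cofactor_def mat_delete_def)
qed

text \<open>
  The skew block structure encodes multiplication by \<open>X + \<i> B\<close> and \<open>X - \<i> B\<close>: on a pair
  \<open>(x, y)\<close> of block vectors the matrix acts on \<open>x - \<i> y\<close> as the former and on \<open>x + \<i> y\<close> as the
  latter. Introducing \<open>y - \<i> x\<close> as a coordinate in place of \<open>y\<close> therefore makes the matrix block
  triangular.
\<close>

lemma det_four_block_mat_skew:
  fixes X B :: "complex mat"
  assumes X: "X \<in> carrier_mat n n" and B: "B \<in> carrier_mat n n"
  shows "det (four_block_mat X B (- B) X) = det (X + \<i> \<cdot>\<^sub>m B) * det (X - \<i> \<cdot>\<^sub>m B)"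
proof -
  define E where "E c = four_block_mat (1\<^sub>m n) (0\<^sub>m n n) (c \<cdot>\<^sub>m 1\<^sub>m n) (1\<^sub>m n)" for c :: complex
  have E: "E c \<in> carrier_mat (n + n) (n + n)" for c
    by (simp add: E_def)
  have det_E: "det (E c) = 1" for c
    unfolding E_def by (subst det_four_block_mat_upper_right_zero[where n = n and m = n]) auto
  have M: "four_block_mat X B (- B) X \<in> carrier_mat (n + n) (n + n)"
    using X B by auto
  have scalar: "(c \<cdot>\<^sub>m 1\<^sub>m n) * A = c \<cdot>\<^sub>m A" "A * (c \<cdot>\<^sub>m 1\<^sub>m n) = c \<cdot>\<^sub>m A"
    if "A \<in> carrier_mat n n" for A and c :: complex
    using mult_smult_assoc_mat[OF one_carrier_mat that] mult_smult_distrib[OF that one_carrier_mat] that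
    by simp_all
  \<comment> \<open>\<open>E (- \<i>)\<close> is the inverse of \<open>E \<i>\<close>, so this is the change of coordinates.\<close>
  have "E (- \<i>) * (four_block_mat X B (- B) X * E \<i>) =
      four_block_mat (X + \<i> \<cdot>\<^sub>m B) B (0\<^sub>m n n) (X - \<i> \<cdot>\<^sub>m B)"
  proof -
    have 1: "four_block_mat X B (- B) X * E \<i> =
        four_block_mat (X + \<i> \<cdot>\<^sub>m B) B (- B + \<i> \<cdot>\<^sub>m X) X"
      unfolding E_def using X B
      by (subst mult_four_block_mat[of _ n n _ n _ n _ _ n _ n])
         (auto simp: scalar)
    show ?thesis
      unfolding 1 unfolding E_def using X B
      by (subst mult_four_block_mat[of _ n n _ n _ n _ _ n _ n])
         (auto intro!: cong_four_block_mat eq_matI simp: scalar algebra_simps)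
  qed
  moreover have "det (E (- \<i>) * (four_block_mat X B (- B) X * E \<i>)) = det (four_block_mat X B (- B) X)"
    using det_mult[OF E mult_carrier_mat[OF M E]] det_mult[OF M E] det_E by simp
  moreover have "det (four_block_mat (X + \<i> \<cdot>\<^sub>m B) B (0\<^sub>m n n) (X - \<i> \<cdot>\<^sub>m B)) =
      det (X + \<i> \<cdot>\<^sub>m B) * det (X - \<i> \<cdot>\<^sub>m B)"
    using X B by (intro det_four_block_mat_lower_left_zero) auto
  ultimately show ?thesis
    by simp
qed

text \<open>A quarter of the discriminant of the characteristic polynomial of \<open>X + \<i> B\<close>.\<close>

definition discr :: "real ^ 5 \<Rightarrow> complex" where
  "discr \<nu> = Complex ((\<nu> $ 2)\<^sup>2 - (\<nu> $ 3)\<^sup>2 - (\<nu> $ 4)\<^sup>2) (- 2 * \<nu> $ 2 * \<nu> $ 4)"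

lemma eigenvalue_L_r_iff:
  "eigenvalue (map_mat complex_of_real (L_r \<nu>)) z \<longleftrightarrow>
     (z - Complex (\<nu> $ 1) (1 + \<nu> $ 5))\<^sup>2 = discr \<nu> \<or>
     (z - Complex (\<nu> $ 1) (- 1 - \<nu> $ 5))\<^sup>2 = cnj (discr \<nu>)"
proof -
  \<comment> \<open>The matrix of \<open>L_r \<nu> - z\<close> has the same skew form, as \<open>- z\<close> only changes the diagonal blocks.\<close>
  define X :: "complex mat" where "X = mat_of_rows_list 2
    [[\<nu> $ 1 - z, \<nu> $ 4], [- \<nu> $ 4, \<nu> $ 1 - z]]"
  define B :: "complex mat" where "B = mat_of_rows_list 2
    [[1 + \<nu> $ 5 + \<nu> $ 3, \<nu> $ 2], [- \<nu> $ 2, 1 + \<nu> $ 5 - \<nu> $ 3]]"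
  have X: "X \<in> carrier_mat 2 2" and B: "B \<in> carrier_mat 2 2"
    by (simp_all add: X_def B_def mat_of_rows_list_def numeral_2_eq_2)
  have L: "L_r \<nu> \<in> carrier_mat 4 4"
    by (rule carrier_matI) (simp_all add: L_r_def M5_def)
  have "char_matrix (map_mat complex_of_real (L_r \<nu>)) z = four_block_mat X B (- B) X"
    unfolding char_matrix_def
    by (rule eq_matI)
       (auto simp: L_r_def M8_def M1_def M4_def M5_def M6_def matL_def matJ_def matR_def
         mat_of_rows_list_def X_def B_def less_Suc_eq numeral_eq_Suc)
  moreover have "det (X + \<i> \<cdot>\<^sub>m B) = (z - Complex (\<nu> $ 1) (1 + \<nu> $ 5))\<^sup>2 - discr \<nu>"
    using X B
    by (subst det_two_dim)
       (auto simp: X_def B_def mat_of_rows_list_def discr_def complex_eq_iff power2_eq_square algebra_simps)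
  moreover have "det (X - \<i> \<cdot>\<^sub>m B) = (z - Complex (\<nu> $ 1) (- 1 - \<nu> $ 5))\<^sup>2 - cnj (discr \<nu>)"
    using X B
    by (subst det_two_dim)
       (auto simp: X_def B_def mat_of_rows_list_def discr_def complex_eq_iff power2_eq_square algebra_simps)
  moreover have "eigenvalue (map_mat complex_of_real (L_r \<nu>)) z \<longleftrightarrow>
      det (char_matrix (map_mat complex_of_real (L_r \<nu>)) z) = 0"
    using L by (intro eigenvalue_det) auto
  ultimately show ?thesis
    by (simp add: det_four_block_mat_skew[OF X B])
qed

text \<open>
  As a polynomial in \<open>x = (\<nu> $ 1)\<^sup>2\<close>, the function \<open>F\<close> is \<open>x\<^sup>2 - x * Re w - (Im w / 2)\<^sup>2\<close> where
  \<open>w\<close> is \<open>discr \<nu>\<close>. If \<open>p + \<i> q\<close> is a square root of \<open>w\<close>, then \<open>Re w = p\<^sup>2 - q\<^sup>2\<close> and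
  \<open>Im w / 2 = p * q\<close>, so the roots of this polynomial are \<open>p\<^sup>2\<close> and \<open>- q\<^sup>2\<close>.
\<close>

lemma F_eq_csqrt_discr:
  "F \<nu> = ((\<nu> $ 1)\<^sup>2 - (Re (csqrt (discr \<nu>)))\<^sup>2) * ((\<nu> $ 1)\<^sup>2 + (Im (csqrt (discr \<nu>)))\<^sup>2)"
proof -
  define p q where "p = Re (csqrt (discr \<nu>))" and "q = Im (csqrt (discr \<nu>))"
  have "Complex p q ^ 2 = discr \<nu>"
    by (simp add: p_def q_def del: csqrt.sel)
  then have Re: "p\<^sup>2 - q\<^sup>2 = (\<nu> $ 2)\<^sup>2 - (\<nu> $ 3)\<^sup>2 - (\<nu> $ 4)\<^sup>2" and Im: "p * q = - (\<nu> $ 2 * \<nu> $ 4)"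
    unfolding complex_eq_iff by (auto simp: discr_def power2_eq_square)
  have "((\<nu> $ 1)\<^sup>2 - p\<^sup>2) * ((\<nu> $ 1)\<^sup>2 + q\<^sup>2) = (\<nu> $ 1)^4 - (\<nu> $ 1)\<^sup>2 * (p\<^sup>2 - q\<^sup>2) - (p * q)\<^sup>2"
    by (simp add: power2_eq_square power4_eq_xxxx algebra_simps)
  also have "\<dots> = F \<nu>"
    unfolding Re Im F_def by (simp add: power2_eq_square power4_eq_xxxx algebra_simps)
  finally show ?thesis
    unfolding p_def q_def by simp
qed

text \<open>
  Among the four eigenvalues the largest real part is \<open>\<nu> $ 1 + Re s\<close>, since the principal square
  root \<open>s\<close> has a nonnegative real part. For \<open>\<nu> $ 1 < 0\<close> the factor of \<open>F\<close> with the imaginary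
  part of \<open>s\<close> is positive, so the sign of \<open>F\<close> compares \<open>- \<nu> $ 1\<close> with \<open>Re s\<close>.
\<close>

lemma stability_domain_L_r: "stability_domain L_r = {\<nu>. \<nu> $ 1 < 0 \<and> 0 < F \<nu>}"
proof -
  have "\<nu> \<in> stability_domain L_r \<longleftrightarrow> \<nu> $ 1 < 0 \<and> 0 < F \<nu>" for \<nu>
  proof -
    define s where "s = csqrt (discr \<nu>)"
    have s: "s\<^sup>2 = discr \<nu>" and Re_s: "0 \<le> Re s"
      using csqrt_principal[of "discr \<nu>"] by (auto simp: s_def)
    have cnj_s: "(cnj s)\<^sup>2 = cnj (discr \<nu>)"
      by (simp flip: s)
    have "eigenvalue (map_mat complex_of_real (L_r \<nu>)) z \<longleftrightarrow>
        (z - Complex (\<nu> $ 1) (1 + \<nu> $ 5) = s \<or> z - Complex (\<nu> $ 1) (1 + \<nu> $ 5) = - s) \<or>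
        (z - Complex (\<nu> $ 1) (- 1 - \<nu> $ 5) = cnj s \<or> z - Complex (\<nu> $ 1) (- 1 - \<nu> $ 5) = - cnj s)"
      for z
      unfolding eigenvalue_L_r_iff cnj_s[symmetric] unfolding s[symmetric] power2_eq_iff ..
    then have ev: "eigenvalue (map_mat complex_of_real (L_r \<nu>)) z \<longleftrightarrow>
        z \<in> {Complex (\<nu> $ 1) (1 + \<nu> $ 5) + s, Complex (\<nu> $ 1) (1 + \<nu> $ 5) - s,
             Complex (\<nu> $ 1) (- 1 - \<nu> $ 5) + cnj s, Complex (\<nu> $ 1) (- 1 - \<nu> $ 5) - cnj s}" for z
      by (auto simp: algebra_simps)
    have "\<nu> \<in> stability_domain L_r \<longleftrightarrow> \<nu> $ 1 + Re s < 0"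
      using Re_s by (auto simp: stability_domain_def ev)
    also have "\<dots> \<longleftrightarrow> \<nu> $ 1 < 0 \<and> (Re s)\<^sup>2 < (\<nu> $ 1)\<^sup>2"
      using Re_s abs_le_square_iff[of "\<nu> $ 1" "Re s"] by auto
    also have "\<dots> \<longleftrightarrow> \<nu> $ 1 < 0 \<and> 0 < F \<nu>"
    proof -
      have "0 < (\<nu> $ 1)\<^sup>2 + (Im s)\<^sup>2" if "\<nu> $ 1 < 0"
        using that by (intro add_pos_nonneg) auto
      then show ?thesis
        unfolding F_eq_csqrt_discr s_def[symmetric] by (auto simp: zero_less_mult_iff)
    qed
    finally show ?thesis .
  qed
  then show ?thesis
    by blast
qed

theorem lemma2p3:
  shows "frontier (stability_domain L_r) \<subseteq> critical_set"
proof
  fix \<nu>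
  assume "\<nu> \<in> frontier (stability_domain L_r)"
  have cont_F: "continuous_on UNIV F"
    unfolding F_def by (intro continuous_intros)
  have "open (stability_domain L_r)"
    unfolding stability_domain_L_r
    by (intro open_Collect_conj open_Collect_less cont_F continuous_intros)
  then have out: "\<nu> \<notin> stability_domain L_r"
    using \<open>\<nu> \<in> _\<close> by (simp add: frontier_def interior_open)
  have "closed {\<nu>. \<nu> $ 1 \<le> 0 \<and> 0 \<le> F \<nu>}"
    by (intro closed_Collect_conj closed_Collect_le cont_F continuous_intros)
  then have "closure (stability_domain L_r) \<subseteq> {\<nu>. \<nu> $ 1 \<le> 0 \<and> 0 \<le> F \<nu>}"
    by (intro closure_minimal) (auto simp: stability_domain_L_r)
  then have le: "\<nu> $ 1 \<le> 0" "0 \<le> F \<nu>"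
    using \<open>\<nu> \<in> _\<close> by (auto simp: frontier_def)
  have "F \<nu> \<le> 0"
  proof (cases "\<nu> $ 1 = 0")
    case True
    then show ?thesis
      by (simp add: F_def)
  next
    case False
    then show ?thesis
      using le out by (auto simp: stability_domain_L_r)
  qed
  then show "\<nu> \<in> critical_set"
    using le by (simp add: critical_set_def)
qed

end
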